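(* If $X\subseteq\mathbb{R}$ is a Sierpiński set, then $C_p(X)$ is an Ascoli space which is not an $s_{\mathbb{R}}$-space. Consequently, under the Continuum Hypothesis, there exists a separable metrizable space $X$ such that $C_p(X)$ is an Ascoli space but not a $k_{\mathbb{R}}$-space.
   Context: A Sierpiński set is an uncountable subset of $\mathbb{R}$ whose intersection with every Lebesgue measure zero set is countable; it carries the subspace topology. $C_p(X)$ is the space of continuous real-valued functions on $X$ with the topology of pointwise convergence; $C_k(Z)$ is the space of continuous real-valued functions on $Z$ with the compact-open topology. A Tychonoff space $Z$ is Ascoli if every compact subset $\mathcal{K}$ of $C_k(Z)$ is evenly continuous, i.e., the map $Z\times\mathcal{K}\to\mathbb{R}$, $(z,f)\mapsto f(z)$, is continuous (equivalently, every compact subset of $C_k(Z)$ is equicontinuous). A function $f:Z\to\mathbb{R}$ is $k$-continuous if its restriction to every compact subset of $Z$ is continuous, and $s$-continuous if its restriction to each convergent sequence in $Z$ (together with its limit) is continuous. $Z$ is a $k_{\mathbb{R}}$-space (resp. an $s_{\mathbb{R}}$-space) if every $k$-continuous (resp. $s$-continuous) function $f:Z\to\mathbb{R}$ is continuous. *)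

theory Defs
  imports "HOL-Analysis.Analysis"
begin

definition sierpinski_set :: "real set \<Rightarrow> bool" where
  "sierpinski_set X \<longleftrightarrow>
     uncountable X \<and> (\<forall>N \<in> null_sets lebesgue. countable (X \<inter> N))"

definition continuum_hypothesis :: bool where
  "continuum_hypothesis \<longleftrightarrow> (card_of (UNIV :: real set), cardSuc natLeq) \<in> ordIso"

(* Real-valued functions on a space are represented by HOL functions that take the value
   undefined outside the carrier, as in product_topology; otherwise functions that agree on
   the space would be different points. *)
definition real_continuous_functions :: "'a topology \<Rightarrow> ('a \<Rightarrow> real) set" where
  "real_continuous_functions Z =
     {f \<in> extensional (topspace Z). continuous_map Z euclideanreal f}"

definition Cp :: "'a topology \<Rightarrow> ('a \<Rightarrow> real) topology" where
  "Cp Z = subtopology (powertop_real (topspace Z)) (real_continuous_functions Z)"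

definition Ck :: "'a topology \<Rightarrow> ('a \<Rightarrow> real) topology" where
  "Ck Z = topology_generated_by
     {{f \<in> real_continuous_functions Z. f ` K \<subseteq> U} | K U. compactin Z K \<and> open U}"

lemma topspace_Cp: "topspace (Cp Z) = real_continuous_functions Z"
  by (auto simp: Cp_def real_continuous_functions_def PiE_def)

lemma topspace_Ck: "topspace (Ck Z) = real_continuous_functions Z"
proof
  show "topspace (Ck Z) \<subseteq> real_continuous_functions Z"
    unfolding Ck_def topology_generated_by_topspace by blast
  have "real_continuous_functions Z
          = {f \<in> real_continuous_functions Z. f ` {} \<subseteq> (UNIV :: real set)}"
    by simp
  then show "real_continuous_functions Z \<subseteq> topspace (Ck Z)"
    unfolding Ck_def topology_generated_by_topspace
    by (intro Union_upper) (use compactin_empty open_UNIV in blast)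
qed

definition evenly_continuous :: "'a topology \<Rightarrow> ('a \<Rightarrow> real) set \<Rightarrow> bool" where
  "evenly_continuous Z \<K> \<longleftrightarrow>
     continuous_map (prod_topology Z (subtopology (Ck Z) \<K>)) euclideanreal (\<lambda>(z, f). f z)"

(* The library's completely_regular_space does not include any separation axiom. *)
definition Tychonoff_space :: "'a topology \<Rightarrow> bool" where
  "Tychonoff_space Z \<longleftrightarrow> completely_regular_space Z \<and> Hausdorff_space Z"

definition Ascoli_space :: "'a topology \<Rightarrow> bool" where
  "Ascoli_space Z \<longleftrightarrow>
     Tychonoff_space Z \<and> (\<forall>\<K>. compactin (Ck Z) \<K> \<longrightarrow> evenly_continuous Z \<K>)"

definition k_continuous :: "'a topology \<Rightarrow> ('a \<Rightarrow> real) \<Rightarrow> bool" where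
  "k_continuous Z f \<longleftrightarrow>
     (\<forall>K. compactin Z K \<longrightarrow> continuous_map (subtopology Z K) euclideanreal f)"

(* limitin only constrains a tail of the sequence, hence the explicit range condition. *)
definition s_continuous :: "'a topology \<Rightarrow> ('a \<Rightarrow> real) \<Rightarrow> bool" where
  "s_continuous Z f \<longleftrightarrow>
     (\<forall>(\<sigma> :: nat \<Rightarrow> 'a) l. range \<sigma> \<subseteq> topspace Z \<and> limitin Z \<sigma> l sequentially \<longrightarrow>
        continuous_map (subtopology Z (insert l (range \<sigma>))) euclideanreal f)"

definition kR_space :: "'a topology \<Rightarrow> bool" where
  "kR_space Z \<longleftrightarrow> (\<forall>f. k_continuous Z f \<longrightarrow> continuous_map Z euclideanreal f)"

definition sR_space :: "'a topology \<Rightarrow> bool" where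
  "sR_space Z \<longleftrightarrow> (\<forall>f. s_continuous Z f \<longrightarrow> continuous_map Z euclideanreal f)"

end

(* A Sierpinski set X is a lambda-set: a countable subset D lies in a null G_delta, which meets X
   in countably many points, and those outside D can be deleted one at a time. If X is a lambda-set
   and f lies in the closure of an open set W of C_p(X), then some sequence in W converges to f.
   Indeed, a member of W stays in W when it is changed off a suitable finite set, so one picks
   g_0, g_1, ... in W with finite sets T_0, T_1, ..., where g_n is close to f on the earlier T_m,
   and moves g_n close to f outside a neighbourhood of the new points of T_n. A G_delta
   representation of the union of all T_n allows neighbourhoods such that each point of X lies in
   only finitely many of them. This convergence property implies the Ascoli property.

   For the negative part, X is not Lebesgue null, so outer measure induces a nonzero finite
   atomless measure nu on the Borel sets of X. The functional mapping f to the nu-integral of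
   min 1 |f| is sequentially continuous by dominated convergence, hence continuous on the compact
   subsets of C_p(X), which are metrizable. It is not continuous at 0, as finite sets are nu-null. *)
theory Submission
  imports Defs
begin

section \<open>A sequential criterion for the Ascoli property\<close>

lemma continuous_map_real_iff:
  "continuous_map Z euclideanreal f \<longleftrightarrow>
     (\<forall>x\<in>topspace Z. \<forall>e>0. \<exists>U. openin Z U \<and> x \<in> U \<and> (\<forall>y\<in>U. \<bar>f y - f x\<bar> < e))"
  using Met_TC.continuous_map_to_metric[of Z f]
  by (simp add: dist_real_def abs_minus_commute)

lemma openin_Ck_subbasic:
  assumes "compactin Z K" "open U"
  shows "openin (Ck Z) {f \<in> real_continuous_functions Z. f ` K \<subseteq> U}"
  unfolding Ck_def using assms by (intro topology_generated_by_Basis) blast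

text \<open>Near \<open>(z, f)\<close>, equicontinuity bounds \<open>g w - g z\<close> uniformly in
  \<open>g\<close>, and the subbasic open set of \<open>Ck Z\<close> given by the compact set
  \<open>{z}\<close> bounds \<open>g z - f z\<close>; each takes half of \<open>e\<close>.\<close>

lemma equicontinuous_imp_evenly_continuous:
  assumes K: "\<K> \<subseteq> real_continuous_functions Z"
    and eq: "\<And>z e. z \<in> topspace Z \<Longrightarrow> e > 0 \<Longrightarrow>
          \<exists>U. openin Z U \<and> z \<in> U \<and> (\<forall>w\<in>U. \<forall>f\<in>\<K>. \<bar>f w - f z\<bar> < e)"
  shows "evenly_continuous Z \<K>"
  unfolding evenly_continuous_def continuous_map_real_iff
proof (intro ballI allI impI)
  fix p and e :: real
  assume p: "p \<in> topspace (prod_topology Z (subtopology (Ck Z) \<K>))" and e: "e > 0"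
  obtain z f where zf: "p = (z, f)"
    by (cases p)
  with p have z: "z \<in> topspace Z" and f: "f \<in> \<K>" "f \<in> real_continuous_functions Z"
    by (auto simp: topspace_Ck)
  obtain U where U: "openin Z U" "z \<in> U" "\<And>w g. w \<in> U \<Longrightarrow> g \<in> \<K> \<Longrightarrow> \<bar>g w - g z\<bar> < e / 2"
    using eq[OF z, of "e / 2"] e by auto
  define V where "V = {g \<in> real_continuous_functions Z. g ` {z} \<subseteq> ball (f z) (e / 2)}"
  have "openin (prod_topology Z (subtopology (Ck Z) \<K>)) (U \<times> (\<K> \<inter> V))"
    using U(1) openin_Ck_subbasic[of Z "{z}" "ball (f z) (e / 2)"] z
    by (auto simp: openin_prod_Times_iff V_def intro: openin_subtopology_Int2)
  moreover have "(z, f) \<in> U \<times> (\<K> \<inter> V)"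
    using U f e by (auto simp: V_def)
  moreover have "\<bar>g w - f z\<bar> < e" if "w \<in> U" "g \<in> \<K> \<inter> V" for w g
  proof -
    have "dist (f z) (g z) < e / 2"
      using that by (simp add: V_def)
    moreover have "\<bar>g w - g z\<bar> < e / 2"
      using U(3) that by blast
    ultimately show ?thesis
      unfolding dist_real_def by linarith
  qed
  ultimately show "\<exists>W. openin (prod_topology Z (subtopology (Ck Z) \<K>)) W \<and> p \<in> W \<and>
      (\<forall>q\<in>W. \<bar>(case q of (w, g) \<Rightarrow> g w) - (case p of (z, f) \<Rightarrow> f z)\<bar> < e)"
    unfolding zf by (intro exI[of _ "U \<times> (\<K> \<inter> V)"]) auto
qed

text \<open>The restriction to open \<open>W\<close>, in contrast to the Frechet-Urysohn property,
  is what later permits changing a member of \<open>W\<close> off a finite set without leaving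
  \<open>W\<close>.\<close>

definition kappa_Frechet_Urysohn :: "'a topology \<Rightarrow> bool" where
  "kappa_Frechet_Urysohn Z \<longleftrightarrow>
     (\<forall>W z. openin Z W \<and> z \<in> Z closure_of W \<longrightarrow>
        (\<exists>\<sigma>. range \<sigma> \<subseteq> W \<and> limitin Z \<sigma> z sequentially))"

text \<open>A tail of the sequence together with its limit is compact, so staying close to a
  constant on it is an open condition in \<open>Ck Z\<close>. Each member of \<open>\<K>\<close>
  satisfies such a condition; a finite subcover leaves finitely many tails, and the largest starting
  index serves them all.\<close>

lemma compactin_Ck_equicontinuous_on_sequence:
  assumes K: "compactin (Ck Z) \<K>" and lim: "limitin Z \<sigma> z sequentially"
    and ran: "range \<sigma> \<subseteq> topspace Z" and e: "e > 0"
  shows "\<exists>N. \<forall>f\<in>\<K>. \<forall>n\<ge>N. \<bar>f (\<sigma> n) - f z\<bar> < e"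
proof -
  have KZ: "\<K> \<subseteq> real_continuous_functions Z"
    using compactin_subset_topspace[OF K] by (simp add: topspace_Ck)
  define V where "V = (\<lambda>g N. {f \<in> real_continuous_functions Z.
      f ` insert z (\<sigma> ` {N..}) \<subseteq> ball (g z) (e / 2)})"
  have "\<exists>N. g \<in> V g N" if "g \<in> \<K>" for g :: "'a \<Rightarrow> real"
  proof -
    have g: "g \<in> real_continuous_functions Z"
      using that KZ by auto
    then have "limitin euclideanreal (g \<circ> \<sigma>) (g z) sequentially"
      by (intro continuous_map_limit[OF _ lim]) (simp add: real_continuous_functions_def)
    then have "(\<lambda>n. g (\<sigma> n)) \<longlonglongrightarrow> g z"
      by (simp add: o_def)
    then obtain N where "\<And>n. n \<ge> N \<Longrightarrow> dist (g (\<sigma> n)) (g z) < e / 2"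
      using e unfolding lim_sequentially by (metis half_gt_zero)
    then show ?thesis
      using e g by (intro exI[of _ N]) (auto simp: V_def dist_commute)
  qed
  then obtain N where N: "\<And>g. g \<in> \<K> \<Longrightarrow> g \<in> V g (N g)"
    by metis
  have "openin (Ck Z) (V g n)" for g n
    unfolding V_def
    by (intro openin_Ck_subbasic compactin_sequence_with_limit[OF lim]) (use ran in auto)
  then have "\<forall>V\<in>(\<lambda>g. V g (N g)) ` \<K>. openin (Ck Z) V"
    by blast
  moreover have "\<K> \<subseteq> (\<Union>g\<in>\<K>. V g (N g))"
    using N by blast
  ultimately obtain \<F> where F: "finite \<F>" "\<F> \<subseteq> (\<lambda>g. V g (N g)) ` \<K>" "\<K> \<subseteq> \<Union>\<F>"
    using K unfolding compactin_def by meson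
  then obtain G where G: "finite G" "G \<subseteq> \<K>" "\<F> = (\<lambda>g. V g (N g)) ` G"
    by (meson finite_subset_image)
  \<comment> \<open>An empty \<open>G\<close> would make \<open>\<K>\<close> empty as well, so the
    unspecified value of \<open>Max\<close> is harmless.\<close>
  have "\<bar>f (\<sigma> n) - f z\<bar> < e" if f: "f \<in> \<K>" and n: "n \<ge> Max (N ` G)" for f n
  proof -
    obtain g where g: "g \<in> G" "f \<in> V g (N g)"
      using f F G by auto
    then have "N g \<le> n"
      using n G(1) by (meson Max_ge finite_imageI image_eqI le_trans)
    then have "dist (g z) (f (\<sigma> n)) < e / 2" "dist (g z) (f z) < e / 2"
      using g(2) by (auto simp: V_def image_subset_iff)
    then show ?thesis
      unfolding dist_real_def by linarith
  qed
  then show ?thesis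
    by blast
qed

text \<open>Were a compact set of functions not equicontinuous at a point \<open>z\<close>, then \<open>z\<close> would lie in the
  closure of the open set of all points at which some member differs from its value at \<open>z\<close> by
  more than a fixed amount, contradicting equicontinuity on a sequence in that set.\<close>

lemma kappa_Frechet_Urysohn_imp_Ascoli_space:
  assumes "Tychonoff_space Z" and kappa: "kappa_Frechet_Urysohn Z"
  shows "Ascoli_space Z"
  unfolding Ascoli_space_def
proof (intro conjI allI impI assms(1))
  fix \<K> assume K: "compactin (Ck Z) \<K>"
  then have KZ: "\<K> \<subseteq> real_continuous_functions Z"
    using compactin_subset_topspace by (metis topspace_Ck)
  show "evenly_continuous Z \<K>"
  proof (rule equicontinuous_imp_evenly_continuous[OF KZ], rule ccontr)
    fix z and e :: real
    assume z: "z \<in> topspace Z" and e: "e > 0"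
      and neg: "\<nexists>U. openin Z U \<and> z \<in> U \<and> (\<forall>w\<in>U. \<forall>f\<in>\<K>. \<bar>f w - f z\<bar> < e)"
    \<comment> \<open>The strict bound makes \<open>W\<close> open; failure of equicontinuity
      supplies values off by at least \<open>e\<close>, which exceeds \<open>e / 2\<close>.\<close>
    define W where "W = (\<Union>f\<in>\<K>. {w \<in> topspace Z. f w \<in> {y. \<bar>y - f z\<bar> > e / 2}})"
    have "openin Z {w \<in> topspace Z. f w \<in> {y. \<bar>y - f z\<bar> > e / 2}}" if "f \<in> \<K>" for f
      using that KZ
      by (intro openin_continuous_map_preimage[of Z euclideanreal])
        (auto simp: real_continuous_functions_def intro!: open_Collect_less continuous_intros)
    then have "openin Z W"
      unfolding W_def by blast
    moreover have "z \<in> Z closure_of W"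
      unfolding in_closure_of
    proof (intro conjI allI impI z)
      fix T assume T: "z \<in> T \<and> openin Z T"
      then obtain w f where "w \<in> T" "f \<in> \<K>" "\<not> \<bar>f w - f z\<bar> < e"
        using neg by blast
      moreover have "w \<in> topspace Z"
        using T \<open>w \<in> T\<close> openin_subset by blast
      ultimately show "\<exists>y. y \<in> W \<and> y \<in> T"
        using e by (force simp: W_def)
    qed
    ultimately obtain \<sigma> where \<sigma>: "range \<sigma> \<subseteq> W" "limitin Z \<sigma> z sequentially"
      using kappa unfolding kappa_Frechet_Urysohn_def by blast
    have "range \<sigma> \<subseteq> topspace Z"
      using \<sigma>(1) by (auto simp: W_def)
    then obtain N where "\<forall>f\<in>\<K>. \<forall>n\<ge>N. \<bar>f (\<sigma> n) - f z\<bar> < e / 2"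
      using compactin_Ck_equicontinuous_on_sequence[OF K \<sigma>(2), of "e / 2"] e by auto
    moreover have "\<sigma> N \<in> W"
      using \<sigma>(1) by blast
    ultimately show False
      by (force simp: W_def)
  qed
qed

lemma Tychonoff_space_Cp: "Tychonoff_space (Cp Z)"
  unfolding Tychonoff_space_def Cp_def
  by (simp add: completely_regular_space_subtopology completely_regular_space_product_topology
      Hausdorff_space_subtopology Hausdorff_space_product_topology
      metrizable_imp_completely_regular_space metrizable_space_euclidean)

section \<open>Function spaces over lambda-sets\<close>

lemma continuous_map_Cp_eval:
  "x \<in> topspace Z \<Longrightarrow> continuous_map (Cp Z) euclideanreal (\<lambda>f. f x)"
  unfolding Cp_def
  by (intro continuous_map_from_subtopology continuous_map_product_projection)

lemma limitin_Cp_iff: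
  "limitin (Cp Z) \<sigma> f F \<longleftrightarrow>
     f \<in> real_continuous_functions Z \<and> (\<forall>\<^sub>F n in F. \<sigma> n \<in> real_continuous_functions Z) \<and>
     (\<forall>x\<in>topspace Z. ((\<lambda>n. \<sigma> n x) \<longlongrightarrow> f x) F)"
  unfolding Cp_def limitin_subtopology limitin_componentwise
  by (auto simp: real_continuous_functions_def PiE_def elim!: eventually_mono)

text \<open>A basic box of the product topology around \<open>g\<close> constrains only finitely
  many coordinates; these form \<open>T\<close>.\<close>

lemma openin_Cp_finite_dependence:
  assumes W: "openin (Cp Z) W" and g: "g \<in> W"
  obtains T where "finite T" "T \<subseteq> topspace Z"
    "\<And>h. h \<in> real_continuous_functions Z \<Longrightarrow> (\<And>x. x \<in> T \<Longrightarrow> h x = g x) \<Longrightarrow> h \<in> W"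
proof -
  obtain V where V: "openin (powertop_real (topspace Z)) V"
      "W = V \<inter> real_continuous_functions Z"
    using W unfolding Cp_def openin_subtopology by blast
  then obtain U where U: "finite {x \<in> topspace Z. U x \<noteq> UNIV}"
      "g \<in> Pi\<^sub>E (topspace Z) U" "Pi\<^sub>E (topspace Z) U \<subseteq> V"
    using g unfolding openin_product_topology_alt by fastforce
  show thesis
  proof
    fix h assume h: "h \<in> real_continuous_functions Z"
      and eq: "\<And>x. x \<in> {x \<in> topspace Z. U x \<noteq> UNIV} \<Longrightarrow> h x = g x"
    have "h x \<in> U x" if "x \<in> topspace Z" for x
      using eq[of x] U(2) that by (cases "U x = UNIV") (auto simp: PiE_iff)
    then have "h \<in> Pi\<^sub>E (topspace Z) U"
      using h by (auto simp: PiE_iff real_continuous_functions_def)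
    then show "h \<in> W"
      using U(3) V(2) h by blast
  qed (use U(1) in auto)
qed

lemma closure_of_Cp_approx:
  assumes f: "f \<in> Cp Z closure_of W" and F: "finite F" "F \<subseteq> topspace Z" and e: "e > 0"
  obtains g where "g \<in> W" "\<And>x. x \<in> F \<Longrightarrow> \<bar>g x - f x\<bar> < e"
proof -
  define V where "V x = {g \<in> topspace (Cp Z). g x \<in> ball (f x) e}" for x
  have "openin (Cp Z) (V x)" if "x \<in> F" for x
    unfolding V_def using that F(2)
    by (intro openin_continuous_map_preimage[OF continuous_map_Cp_eval]) auto
  \<comment> \<open>Intersecting with the whole space matters for empty \<open>F\<close>, where the
    intersection over \<open>F\<close> is \<open>UNIV\<close>.\<close>
  then have "openin (Cp Z) (\<Inter>(V ` F) \<inter> topspace (Cp Z))"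
    using F(1) by (intro openin_INT) auto
  moreover have "f \<in> \<Inter>(V ` F) \<inter> topspace (Cp Z)"
    using f e by (auto simp: V_def in_closure_of)
  ultimately obtain g where "g \<in> W" "g \<in> \<Inter>(V ` F)"
    using f unfolding in_closure_of by blast
  then show thesis
    by (intro that[of g]) (auto simp: V_def dist_real_def abs_minus_commute)
qed

definition lambda_set :: "'a::topological_space set \<Rightarrow> bool" where
  "lambda_set X \<longleftrightarrow>
     (\<forall>D \<subseteq> X. countable D \<longrightarrow> (\<exists>G :: nat \<Rightarrow> 'a set. (\<forall>n. open (G n)) \<and> D = X \<inter> (\<Inter>n. G n)))"

lemma lambda_set_imp_kappa_Frechet_Urysohn_Cp:
  fixes X :: "'a::euclidean_space set"
  assumes lambda: "lambda_set X"
  shows "kappa_Frechet_Urysohn (Cp (top_of_set X))"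
  unfolding kappa_Frechet_Urysohn_def
proof (intro allI impI, elim conjE)
  let ?R = "real_continuous_functions (top_of_set X)"
  fix W f
  assume W: "openin (Cp (top_of_set X)) W" and f: "f \<in> Cp (top_of_set X) closure_of W"
  have R_iff: "h \<in> ?R \<longleftrightarrow> h \<in> extensional X \<and> continuous_on X h" for h
    by (simp add: real_continuous_functions_def)
  have WR: "W \<subseteq> ?R"
    using openin_subset[OF W] by (simp add: topspace_Cp)
  have fR: "f \<in> ?R"
    using f by (simp add: in_closure_of topspace_Cp)
  \<comment> \<open>\<open>T\<close> records finitely many points whose values keep a function in
    \<open>W\<close>; \<open>g\<close> has to be close to \<open>f\<close> only on \<open>F\<close>,
    which will hold the sets chosen earlier.\<close>
  define good where "good F n g T \<longleftrightarrow> g \<in> W \<and> finite T \<and> T \<subseteq> X \<and>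
      (\<forall>h\<in>?R. (\<forall>x\<in>T. h x = g x) \<longrightarrow> h \<in> W) \<and> (\<forall>x\<in>F. \<bar>g x - f x\<bar> < 1 / real (Suc n))"
    for F n g T
  have "\<exists>g T. good F n g T" if F: "finite F" "F \<subseteq> X" for F and n :: nat
  proof -
    obtain g where g: "g \<in> W" "\<And>x. x \<in> F \<Longrightarrow> \<bar>g x - f x\<bar> < 1 / Suc n"
      using closure_of_Cp_approx[OF f F(1), of "1 / Suc n"] F(2) by auto
    obtain T where "finite T" "T \<subseteq> X"
        "\<And>h. h \<in> ?R \<Longrightarrow> (\<And>x. x \<in> T \<Longrightarrow> h x = g x) \<Longrightarrow> h \<in> W"
      using openin_Cp_finite_dependence[OF W g(1)] by auto
    with g have "good F n g T"
      unfolding good_def by auto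
    then show ?thesis
      by blast
  qed
  then obtain \<gamma> \<tau> where \<gamma>\<tau>: "\<And>F n. finite F \<Longrightarrow> F \<subseteq> X \<Longrightarrow> good F n (\<gamma> F n) (\<tau> F n)"
    by metis
  \<comment> \<open>The choice functions \<open>\<gamma>\<close> and \<open>\<tau>\<close> depend on
    the set and the index alone, so it suffices to recurse on \<open>F n\<close>, the union of all
    \<open>T m\<close> with \<open>m < n\<close>.\<close>
  define F where "F = rec_nat {} (\<lambda>n F. F \<union> \<tau> F n)"
  define g where "g n = \<gamma> (F n) n" for n
  define T where "T n = \<tau> (F n) n" for n
  have F_Suc: "F (Suc n) = F n \<union> T n" for n
    by (simp add: F_def T_def)
  have F: "finite (F n) \<and> F n \<subseteq> X" for n
  proof (induction n)
    case 0
    then show ?case by (simp add: F_def)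
  next
    case (Suc n)
    then show ?case
      using \<gamma>\<tau>[of "F n" n] by (simp add: F_Suc T_def good_def)
  qed
  have g: "g n \<in> W" and T: "finite (T n)" "T n \<subseteq> X"
    and dep: "\<And>h. h \<in> ?R \<Longrightarrow> (\<And>x. x \<in> T n \<Longrightarrow> h x = g n x) \<Longrightarrow> h \<in> W"
    and small: "\<And>x. x \<in> F n \<Longrightarrow> \<bar>g n x - f x\<bar> < 1 / Suc n" for n
    using \<gamma>\<tau>[of "F n" n] F[of n] by (auto simp: g_def T_def good_def)
  have "F m \<subseteq> F n" if "m \<le> n" for m n
    using that by (rule lift_Suc_mono_le[of F, rotated]) (simp add: F_Suc)
  then have TF: "T m \<subseteq> F n" if "m < n" for m n
    using that F_Suc[of m] by (metis Suc_leI Un_upper2 order_trans)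

  have "countable (\<Union>n. T n)"
    using T(1) by (intro countable_UN) (auto intro: countable_finite)
  then obtain G :: "nat \<Rightarrow> 'a set" where G: "\<And>n. open (G n)" "(\<Union>n. T n) = X \<inter> (\<Inter>n. G n)"
    using lambda T(2) unfolding lambda_set_def by (metis UN_least)
  \<comment> \<open>A point of some \<open>T m\<close> is removed from every later
    \<open>U n\<close> along with \<open>F n\<close>; a point of \<open>X\<close> in no
    \<open>T m\<close> misses some \<open>G j\<close> and thus every \<open>U n\<close> with
    \<open>n \<ge> j\<close>. So each point of \<open>X\<close> lies in only finitely many
    \<open>U n\<close>, while \<open>U n\<close> still contains \<open>T n - F n\<close>.\<close>
  define U where "U n = (\<Inter>j\<le>n. G j) - F n" for n
  have "open (U n)" for n
    unfolding U_def using G(1) F by (intro open_Diff open_INT finite_imp_closed) auto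
  then have cl1: "closedin (top_of_set X) (X - U n)" for n
    using closedin_diff[OF closedin_topspace, of "top_of_set X" "X \<inter> U n"]
    by (simp add: Diff_Int openin_open_Int)
  have cl2: "closedin (top_of_set X) (T n - F n)" for n
    using T by (intro closed_subset finite_imp_closed) auto
  have disj: "(T n - F n) \<inter> (X - U n) = {}" for n
    using G(2) by (auto simp: U_def)
  have "\<exists>u. continuous_on X u \<and> (\<forall>x\<in>T n - F n. u x = 1) \<and> (\<forall>x\<in>X - U n. u x = (0::real))" for n
  proof -
    obtain u :: "'a \<Rightarrow> real" where "continuous_on X u" "\<And>x. x \<in> T n - F n \<Longrightarrow> u x = 1"
        "\<And>x. x \<in> X - U n \<Longrightarrow> u x = 0"
      using Urysohn_local[OF cl2 cl1 disj, of 1 "0::real"] by metis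
    then show ?thesis
      by blast
  qed
  then obtain u :: "nat \<Rightarrow> 'a \<Rightarrow> real" where u: "\<And>n. continuous_on X (u n)"
      "\<And>n x. x \<in> T n - F n \<Longrightarrow> u n x = 1" "\<And>n x. x \<in> X - U n \<Longrightarrow> u n x = 0"
    by metis
  \<comment> \<open>\<open>c n\<close> truncates \<open>g n - f\<close> at \<open>1 / Suc n\<close>.
    Where \<open>u n\<close> is 0, \<open>h n\<close> is \<open>f + c n\<close>, uniformly close to
    \<open>f\<close>; where \<open>u n\<close> is 1, it is \<open>g n\<close>. On
    \<open>T n \<inter> F n\<close> the truncation changes nothing, so \<open>h n = g n\<close>
    there whatever \<open>u n\<close> is.\<close>
  define c where "c n x = max (- 1 / Suc n) (min (1 / Suc n) (g n x - f x))" for n x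
  define h where "h n = restrict (\<lambda>x. f x + c n x + u n x * (g n x - f x - c n x)) X" for n
  have hR: "h n \<in> ?R" for n
    using g[of n] WR fR u(1)[of n] unfolding R_iff h_def c_def
    by (auto simp: R_iff intro!: continuous_intros cong: continuous_on_cong_simp)
  have hT: "h n x = g n x" if x: "x \<in> T n" for n x
  proof (cases "x \<in> F n")
    case True
    have "c n x = g n x - f x"
      using small[OF True] unfolding c_def by linarith
    then show ?thesis
      using x T(2) by (auto simp: h_def)
  next
    case False
    then show ?thesis
      using x T(2) u(2)[of x n] by (auto simp: h_def)
  qed
  have "h n \<in> W" for n
    using dep[OF hR hT] by blast
  moreover have "(\<lambda>n. h n x) \<longlonglongrightarrow> f x" if x: "x \<in> X" for x
  proof -
    have "\<exists>N. \<forall>n\<ge>N. x \<notin> U n"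
    proof (cases "x \<in> (\<Union>n. T n)")
      case True
      then obtain m where "x \<in> T m"
        by blast
      then have "\<forall>n\<ge>Suc m. x \<notin> U n"
        using TF unfolding U_def by (meson DiffD2 Suc_le_lessD subsetD)
      then show ?thesis ..
    next
      case False
      then obtain j where "x \<notin> G j"
        using G(2) x by auto
      then have "\<forall>n\<ge>j. x \<notin> U n"
        by (auto simp: U_def)
      then show ?thesis ..
    qed
    then have "\<forall>\<^sub>F n in sequentially. x \<notin> U n"
      by (simp add: eventually_sequentially)
    then have "\<forall>\<^sub>F n in sequentially. norm (h n x - f x) \<le> 1 / Suc n"
    proof (rule eventually_mono)
      fix n assume "x \<notin> U n"
      then have "h n x - f x = c n x"
        using x u(3)[of x n] by (simp add: h_def)
      moreover have "\<bar>c n x\<bar> \<le> 1 / Suc n"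
        unfolding c_def by (simp add: abs_le_iff)
      ultimately show "norm (h n x - f x) \<le> 1 / Suc n"
        by simp
    qed
    then have "(\<lambda>n. h n x - f x) \<longlonglongrightarrow> 0"
      by (rule Lim_null_comparison) (rule LIMSEQ_Suc[OF lim_1_over_n])
    then show ?thesis
      by (simp add: LIM_zero_iff)
  qed
  ultimately have "range h \<subseteq> W \<and> limitin (Cp (top_of_set X)) h f sequentially"
    using fR hR by (auto simp: limitin_Cp_iff)
  then show "\<exists>\<sigma>. range \<sigma> \<subseteq> W \<and> limitin (Cp (top_of_set X)) \<sigma> f sequentially"
    by blast
qed


section \<open>Sierpinski sets\<close>

text \<open>Outer regularity gives open supersets of arbitrarily small measure. The sequence itself
  is exposed because one later use deletes points from its terms and another codes it by a set of
  naturals.\<close>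

lemma null_sets_lebesgue_outer_G_delta:
  fixes S :: "real set"
  assumes S: "S \<in> null_sets lebesgue"
  obtains V :: "nat \<Rightarrow> real set"
    where "\<And>n. open (V n)" "\<And>n. S \<subseteq> V n" "(\<Inter>n. V n) \<in> null_sets lebesgue"
proof -
  have "\<exists>V. open V \<and> S \<subseteq> V \<and> emeasure lebesgue V < ennreal (1 / Suc n)" for n
  proof -
    obtain V where V: "open V" "S \<subseteq> V" "V - S \<in> lmeasurable"
        "emeasure lebesgue (V - S) < ennreal (1 / Suc n)"
      using sets_lebesgue_outer_open[of S "1 / Suc n"] S by auto
    then show ?thesis
      using emeasure_Diff_null_set[OF S, of V] by (intro exI[of _ V]) auto
  qed
  then obtain V :: "nat \<Rightarrow> real set" where V: "\<And>n. open (V n)" "\<And>n. S \<subseteq> V n"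
      "\<And>n. emeasure lebesgue (V n) < ennreal (1 / Suc n)"
    by metis
  have le_e: "emeasure lebesgue (\<Inter>n. V n) \<le> ennreal e" if "e > 0" for e
  proof -
    obtain n where "1 / Suc n < e"
      using \<open>e > 0\<close> nat_approx_posE by blast
    have "emeasure lebesgue (\<Inter>n. V n) \<le> emeasure lebesgue (V n)"
      using V(1) by (intro emeasure_mono) auto
    also have "\<dots> \<le> ennreal e"
      using V(3)[of n] \<open>1 / Suc n < e\<close> by (meson ennreal_leI less_imp_le order_trans)
    finally show ?thesis .
  qed
  have "emeasure lebesgue (\<Inter>n. V n) \<le> 0"
    by (rule ennreal_le_epsilon) (use le_e in simp)
  then have "(\<Inter>n. V n) \<in> null_sets lebesgue"
    using V(1) by (intro null_setsI) (auto intro!: sets.countable_INT)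
  with V show thesis
    using that by blast
qed


lemma sierpinski_set_imp_lambda_set:
  assumes "sierpinski_set X"
  shows "lambda_set X"
  unfolding lambda_set_def
proof (intro allI impI)
  fix D assume D: "D \<subseteq> X" "countable D"
  have D0: "D \<in> null_sets lebesgue"
    using countable_imp_null_set_lborel[OF D(2)] by (simp add: null_sets_completionI)
  obtain V :: "nat \<Rightarrow> real set" where V: "\<And>n. open (V n)" "\<And>n. D \<subseteq> V n"
      "(\<Inter>n. V n) \<in> null_sets lebesgue"
    using null_sets_lebesgue_outer_G_delta[OF D0] by blast
  from V(3) have cnt: "countable (X \<inter> (\<Inter>n. V n) - D)"
    using assms unfolding sierpinski_set_def by (blast intro: countable_subset)
  let ?C = "X \<inter> (\<Inter>n. V n) - D"
  \<comment> \<open>Each term loses at most one point of the countable set \<open>?C\<close>.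
    Intersecting with \<open>?C\<close> guards the case of empty \<open>?C\<close>, where
    \<open>from_nat_into\<close> is unspecified.\<close>
  define G where "G n = V n - ({from_nat_into ?C n} \<inter> ?C)" for n
  have "open (G n)" for n
    unfolding G_def using V(1) by (intro open_Diff finite_imp_closed) auto
  moreover have "D = X \<inter> (\<Inter>n. G n)"
  proof
    show "D \<subseteq> X \<inter> (\<Inter>n. G n)"
      using D(1) V(2) by (auto simp: G_def)
  next
    show "X \<inter> (\<Inter>n. G n) \<subseteq> D"
    proof
      fix x assume x: "x \<in> X \<inter> (\<Inter>n. G n)"
      show "x \<in> D"
      proof (rule ccontr)
        assume "x \<notin> D"
        then have "x \<in> ?C"
          using x by (auto simp: G_def)
        then obtain n where "from_nat_into ?C n = x"
          using from_nat_into_surj[OF cnt] by blast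
        moreover have "x \<in> G n"
          using x by blast
        ultimately show False
          using \<open>x \<in> ?C\<close> unfolding G_def by blast
      qed
    qed
  qed
  ultimately show "\<exists>G :: nat \<Rightarrow> real set. (\<forall>n. open (G n)) \<and> D = X \<inter> (\<Inter>n. G n)"
    by blast
qed

section \<open>Construction of a Sierpinski set under the Continuum Hypothesis\<close>

text \<open>Null G_delta sets suffice, and a G_delta set is coded by a set of naturals that lists,
  for each of its open sets, the members of a countable base making it up. There are as many codes
  as reals.\<close>

lemma cofinal_null_sets_indexed_by_reals:
  obtains N :: "real \<Rightarrow> real set"
    where "\<And>a. N a \<in> null_sets lebesgue" "\<And>S. S \<in> null_sets lebesgue \<Longrightarrow> \<exists>a. S \<subseteq> N a"
proof -
  obtain \<phi> :: "real \<Rightarrow> nat set" where \<phi>: "bij \<phi>"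
    using eqpoll_sym[OF nat_sets_eqpoll_reals] unfolding eqpoll_def by blast
  obtain B :: "nat \<Rightarrow> real set" where B: "\<And>S. open S \<Longrightarrow> \<exists>k. S = \<Union>{B n |n. n \<in> k}"
    by (rule univ_second_countable_sequence[where 'a = real]) blast
  define M where "M C = (\<Inter>k. \<Union>{B n |n. prod_encode (k, n) \<in> C})" for C
  \<comment> \<open>Codes of sets that are not null are sent to the empty set, which keeps every
    \<open>N a\<close> null.\<close>
  define N where "N a = (if M (\<phi> a) \<in> null_sets lebesgue then M (\<phi> a) else {})" for a
  show thesis
  proof
    show "N a \<in> null_sets lebesgue" for a
      by (simp add: N_def)
    fix S :: "real set" assume "S \<in> null_sets lebesgue"
    then obtain V :: "nat \<Rightarrow> real set" where V: "\<And>n. open (V n)" "\<And>n. S \<subseteq> V n"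
        "(\<Inter>n. V n) \<in> null_sets lebesgue"
      using null_sets_lebesgue_outer_G_delta by blast
    have "\<forall>k. \<exists>K. V k = \<Union>{B n |n. n \<in> K}"
      using B[OF V(1)] by blast
    then obtain K where K: "\<And>k. V k = \<Union>{B n |n. n \<in> K k}"
      by (elim choice[THEN exE]) blast
    obtain a where a: "{prod_encode (k, n) |k n. n \<in> K k} = \<phi> a"
      by (rule surjE[OF bij_is_surj[OF \<phi>]])
    have "M (\<phi> a) = (\<Inter>k. V k)"
      by (simp add: M_def K flip: a)
    then show "\<exists>a. S \<subseteq> N a"
      using V(2,3) by (intro exI[of _ a]) (auto simp: N_def)
  qed
qed

text \<open>In the cardinal well-order of the reals, the predecessors of a point have smaller
  cardinality than the reals; below the successor of aleph_0 this means countable.\<close>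

lemma continuum_hypothesis_countable_well_order:
  includes cardinal_syntax
  assumes continuum_hypothesis
  obtains r :: "real rel"
    where "Well_order r" "Field r = UNIV" "\<And>a. countable (underS r a)"
proof
  let ?r = "card_of (UNIV :: real set)"
  show "Well_order ?r"
    by (rule card_of_Well_order)
  show "Field ?r = UNIV"
    by (rule Field_card_of)
  fix a
  have "card_of (underS ?r a) <o ?r"
    using card_of_underS[OF card_of_Card_order, of a UNIV] by (simp add: Field_card_of)
  also have "?r =o cardSuc natLeq"
    using assms by (simp add: continuum_hypothesis_def)
  finally have "card_of (underS ?r a) \<le>o natLeq"
    using cardSuc_ordLeq_ordLess[OF natLeq_Card_order card_of_Card_order] by blast
  then have "card_of (underS ?r a) \<le>o card_of (UNIV :: nat set)"
    using card_of_nat ordIso_symmetric ordLeq_ordIso_trans by blast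
  then obtain f :: "real \<Rightarrow> nat" where "inj_on f (underS ?r a)"
    unfolding card_of_ordLeq[symmetric] by blast
  then show "countable (underS ?r a)"
    by (rule countableI)
qed

text \<open>A point outside the union of all earlier null sets of the cofinal family, and different from
  all earlier points, is chosen at each stage of the well-order.\<close>

lemma continuum_hypothesis_imp_sierpinski_set:
  assumes continuum_hypothesis
  obtains X where "sierpinski_set X"
proof -
  obtain r :: "real rel" where r: "Well_order r" "Field r = UNIV"
      and countable_underS: "\<And>a. countable (underS r a)"
    using continuum_hypothesis_countable_well_order[OF assms] by blast
  obtain N :: "real \<Rightarrow> real set" where N: "\<And>a. N a \<in> null_sets lebesgue"
      "\<And>S. S \<in> null_sets lebesgue \<Longrightarrow> \<exists>a. S \<subseteq> N a"
    using cofinal_null_sets_indexed_by_reals by blast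
  have less_iff: "(b, a) \<in> r - Id \<longleftrightarrow> b \<in> underS r a" for a b
    by (auto simp: underS_def)
  have "wf (r - Id)"
    using r(1) by (simp add: well_order_on_def)
  then have "\<exists>x. \<forall>a. x a \<notin> x ` underS r a \<union> (\<Union>b\<in>underS r a. N b)"
  proof (rule dependent_wf_choice)
    fix x :: "real \<Rightarrow> real" and a
    \<comment> \<open>As \<open>underS r a\<close> is countable, the set to be avoided is a
      countable union of null sets, hence not the whole line.\<close>
    have "x ` underS r a \<in> null_sets lebesgue"
      by (intro null_sets_completionI countable_imp_null_set_lborel countable_image countable_underS)
    then have "x ` underS r a \<union> (\<Union>b\<in>underS r a. N b) \<in> null_sets lebesgue"
      by (intro null_sets.Un null_sets_UN' countable_underS N(1))
    moreover have "UNIV \<notin> null_sets (lebesgue :: real measure)"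
      by (simp add: null_sets_def)
    ultimately show "\<exists>v. v \<notin> x ` underS r a \<union> (\<Union>b\<in>underS r a. N b)"
      by (metis UNIV_eq_I)
  next
    fix x y :: "real \<Rightarrow> real" and a v
    assume "\<And>b. (b, a) \<in> r - Id \<Longrightarrow> x b = y b"
    then have "x ` underS r a = y ` underS r a"
      unfolding less_iff by (rule image_cong[OF refl])
    then show "(v \<notin> x ` underS r a \<union> (\<Union>b\<in>underS r a. N b)) =
        (v \<notin> y ` underS r a \<union> (\<Union>b\<in>underS r a. N b))"
      by simp
  qed
  then obtain x where x: "\<And>a b. b \<in> underS r a \<Longrightarrow> x a \<noteq> x b \<and> x a \<notin> N b"
    by blast
  have total: "a = b \<or> a \<in> underS r b \<or> b \<in> underS r a" for a b
    using r unfolding well_order_on_def linear_order_on_def total_on_def underS_def by auto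
  have "inj x"
    using x total by (metis injI)
  then have "uncountable (range x)"
    using countable_image_inj_eq uncountable_UNIV_real by blast
  moreover have "countable (range x \<inter> S)" if "S \<in> null_sets lebesgue" for S
  proof -
    obtain b where "S \<subseteq> N b"
      using N(2)[OF \<open>S \<in> null_sets lebesgue\<close>] by blast
    \<comment> \<open>If \<open>x a\<close> lies in \<open>N b\<close>, then \<open>b\<close> does
      not precede \<open>a\<close>, so totality leaves \<open>a = b\<close> or \<open>a\<close>
      before \<open>b\<close>.\<close>
    then have "range x \<inter> S \<subseteq> x ` insert b (underS r b)"
      using x total by blast
    then show ?thesis
      using countable_underS[of b] by (meson countable_image countable_insert countable_subset)
  qed
  ultimately show thesis
    using that[of "range x"] by (simp add: sierpinski_set_def)
qed

section \<open>A sequentially continuous functional\<close>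

text \<open>A convergent sequence with its limit is compact. Hence one discontinuous
  \<open>k_continuous\<close> functional refutes both \<open>kR_space\<close> and
  \<open>sR_space\<close>.\<close>

lemma k_continuous_imp_s_continuous: "k_continuous Z f \<Longrightarrow> s_continuous Z f"
  unfolding s_continuous_def
proof (intro allI impI, elim conjE)
  fix \<sigma> :: "nat \<Rightarrow> 'a" and l
  assume f: "k_continuous Z f" and "range \<sigma> \<subseteq> topspace Z" "limitin Z \<sigma> l sequentially"
  then have "compactin Z (insert l (range \<sigma>))"
    by (intro compactin_sequence_with_limit) auto
  with f show "continuous_map (subtopology Z (insert l (range \<sigma>))) euclideanreal f"
    by (simp add: k_continuous_def)
qed

lemma sequentially_continuous_imp_continuous_map:
  fixes f :: "'a \<Rightarrow> real"
  assumes "metrizable_space Y"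
    and seq: "\<And>\<sigma> l. range \<sigma> \<subseteq> topspace Y \<Longrightarrow> limitin Y \<sigma> l sequentially \<Longrightarrow>
          (\<lambda>n. f (\<sigma> n)) \<longlonglongrightarrow> f l"
  shows "continuous_map Y euclideanreal f"
  unfolding continuous_map_closedin
proof (intro conjI allI impI)
  fix C :: "real set" assume C: "closedin euclideanreal C"
  obtain M d where "Metric_space M d" and Y: "Y = Metric_space.mtopology M d"
    using assms(1) unfolding metrizable_space_def by blast
  then interpret Metric_space M d
    by simp
  show "closedin Y {x \<in> topspace Y. f x \<in> C}"
    unfolding Y metric_closedin_iff_sequentially_closed
  proof (intro conjI allI impI)
    fix \<sigma> l assume \<sigma>: "range \<sigma> \<subseteq> {x \<in> topspace mtopology. f x \<in> C} \<and> limitin mtopology \<sigma> l sequentially"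
    then have "(\<lambda>n. f (\<sigma> n)) \<longlonglongrightarrow> f l"
      by (intro seq) (auto simp: Y)
    moreover have "f (\<sigma> n) \<in> C" for n
      using \<sigma> by blast
    ultimately have "f l \<in> C"
      using C closed_sequentially[of C "\<lambda>n. f (\<sigma> n)" "f l"] by simp
    then show "l \<in> {x \<in> topspace mtopology. f x \<in> C}"
      using \<sigma> limitin_topspace by fastforce
  qed auto
qed auto

lemma separable_space_top_of_set:
  fixes X :: "'a::{metric_space, second_countable_topology} set"
  shows "separable_space (top_of_set X)"
proof -
  obtain T where "countable T" "T \<subseteq> X" "X \<subseteq> closure T"
    using separable by blast
  then show ?thesis
    unfolding separable_space_def
    by (intro exI[of _ T]) (auto simp: closure_of_subtopology Int_absorb1)
qed

text \<open>Restriction to a countable dense set \<open>D\<close> is a continuous injection into the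
  metrizable space of real functions on \<open>D\<close>; on a compact set, a continuous injection
  into a Hausdorff space is an embedding.\<close>

lemma metrizable_space_compactin_Cp:
  assumes "separable_space Z" and K: "compactin (Cp Z) K"
  shows "metrizable_space (subtopology (Cp Z) K)"
proof -
  obtain D where D: "countable D" "D \<subseteq> topspace Z" "Z closure_of D = topspace Z"
    using assms(1) unfolding separable_space_def by blast
  have KZ: "K \<subseteq> real_continuous_functions Z"
    using compactin_subset_topspace[OF K] by (simp add: topspace_Cp)
  let ?r = "\<lambda>f :: 'a \<Rightarrow> real. restrict f D"
  have "continuous_map (Cp Z) euclideanreal (\<lambda>f. ?r f x)" if "x \<in> D" for x
    using continuous_map_Cp_eval[of x Z] that D(2) by (simp add: subset_iff)
  then have "continuous_map (Cp Z) (powertop_real D) ?r"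
    by (simp add: continuous_map_componentwise image_subset_iff)
  then have "continuous_map (subtopology (Cp Z) K) (powertop_real D) ?r"
    by (rule continuous_map_from_subtopology)
  moreover have "inj_on ?r (topspace (subtopology (Cp Z) K))"
  proof (rule inj_onI)
    fix f g assume "f \<in> topspace (subtopology (Cp Z) K)" "g \<in> topspace (subtopology (Cp Z) K)"
      and eq: "?r f = ?r g"
    then have f: "f \<in> extensional (topspace Z)" "continuous_map Z euclideanreal f"
      and g: "g \<in> extensional (topspace Z)" "continuous_map Z euclideanreal g"
      by (auto simp: topspace_Cp real_continuous_functions_def)
    have "f x = g x" if "x \<in> topspace Z" for x
    proof (rule forall_in_closure_of_eq[of x Z D euclideanreal f g])
      show "f x = g x" if "x \<in> D" for x
        using eq that by (metis restrict_apply')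
    qed (use that D(3) f g in auto)
    then show "f = g"
      using f g by (metis extensionalityI)
  qed
  moreover have "Hausdorff_space (powertop_real D)"
    by (simp add: Hausdorff_space_product_topology)
  ultimately have "embedding_map (subtopology (Cp Z) K) (powertop_real D) ?r"
    using K by (intro continuous_imp_embedding_map compact_space_subtopology) auto
  then have "subtopology (Cp Z) K homeomorphic_space
      subtopology (powertop_real D) (?r ` topspace (subtopology (Cp Z) K))"
    by (rule embedding_map_imp_homeomorphic_space)
  moreover have "metrizable_space (powertop_real D)"
    unfolding metrizable_space_product_topology
    using D(1) by (auto simp: metrizable_space_euclidean intro: countable_subset)
  ultimately show ?thesis
    by (simp add: homeomorphic_metrizable_space metrizable_space_subtopology)
qed

section \<open>A finite atomless measure on a non-null set\<close>

text \<open>\<open>X\<close> need not be measurable, and outer measure is not additive in general.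
  But a bounded non-null part \<open>A\<close> of \<open>X\<close> has a Borel envelope
  \<open>E\<close>: for Borel \<open>B\<close> the outer measure of \<open>B \<inter> A\<close> is
  the measure of \<open>B \<inter> E\<close>, which yields countable additivity on the traces
  \<open>X \<inter> B\<close>.\<close>

lemma non_null_trace_measure:
  fixes X :: "'a::euclidean_space set"
  assumes "X \<notin> null_sets lebesgue"
  obtains \<nu> where "finite_measure \<nu>" "sets \<nu> = sets (restrict_space borel X)"
    "measure \<nu> X > 0" "\<And>x. x \<in> X \<Longrightarrow> {x} \<in> null_sets \<nu>"
proof -
  \<comment> \<open>A bounded piece is selected so that the envelope, and with it the resulting
    measure, is finite.\<close>
  have "\<exists>n::nat. X \<inter> cball 0 n \<notin> null_sets lebesgue"
  proof (rule ccontr)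
    assume "\<nexists>n::nat. X \<inter> cball 0 n \<notin> null_sets lebesgue"
    then have "(\<Union>n::nat. X \<inter> cball 0 n) \<in> null_sets lebesgue"
      by (intro null_sets_UN) auto
    moreover have "(\<Union>n::nat. X \<inter> cball 0 n) = X"
      using real_arch_simple by auto
    ultimately show False
      using assms by simp
  qed
  then obtain n :: nat where n: "X \<inter> cball 0 n \<notin> null_sets lebesgue" ..
  define A where "A = X \<inter> cball 0 n"
  obtain E where E: "E \<in> sets lborel" "A \<subseteq> E" "outer_measure_of lborel A = emeasure lborel E"
    using outer_measure_of_attain[of A lborel] by auto
  have E0: "emeasure lborel E \<noteq> 0"
  proof
    assume "emeasure lborel E = 0"
    then have "E \<in> null_sets lborel"
      using E(1) by blast
    then have "A \<in> null_sets lebesgue"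
      using E(2) null_sets_completionI null_sets_completion_subset by blast
    then show False
      using n by (simp add: A_def)
  qed
  have "emeasure lborel E \<le> outer_measure_of lborel (cball (0::'a) n)"
    unfolding E(3)[symmetric] A_def by (intro outer_measure_of_mono) auto
  also have "\<dots> < \<infinity>"
    using emeasure_lborel_cball_finite by simp
  finally have Efin: "emeasure lborel E < \<infinity>" .
  then have "measurable_envelope lborel A E"
    using E by (simp add: measurable_envelope_eq2)
  then have env: "outer_measure_of lborel (B \<inter> A) = emeasure lborel (B \<inter> E)" if "B \<in> sets borel" for B
    using that by (simp add: measurable_envelope_def)
  define \<mu> where "\<mu> S = outer_measure_of lborel (S \<inter> A)" for S
  have \<mu>: "\<mu> (X \<inter> B) = emeasure lborel (B \<inter> E)" if "B \<in> sets borel" for B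
  proof -
    have "X \<inter> B \<inter> A = B \<inter> A"
      by (auto simp: A_def)
    then show ?thesis
      using env[OF that] by (simp add: \<mu>_def)
  qed
  let ?\<S> = "sets (restrict_space borel X)"
  define \<nu> where "\<nu> = measure_of X ?\<S> \<mu>"
  have sets: "sets \<nu> = ?\<S>" and space: "space \<nu> = X"
    using sets.space_closed[of "restrict_space borel X"] sets.sigma_sets_eq[of "restrict_space borel X"]
    by (auto simp: \<nu>_def space_restrict_space)
  have "countably_additive ?\<S> \<mu>"
  proof (rule countably_additiveI)
    fix S :: "nat \<Rightarrow> 'a set"
    assume S: "range S \<subseteq> ?\<S>" "disjoint_family S"
    then have "\<forall>i. \<exists>B\<in>sets borel. S i = X \<inter> B"
      by (auto simp: sets_restrict_space)
    then obtain B where B: "\<And>i. B i \<in> sets borel" "\<And>i. S i = X \<inter> B i"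
      by metis
    \<comment> \<open>The \<open>S i\<close> are disjoint, but their Borel representatives may
      overlap outside \<open>X\<close>; \<open>disjointed\<close> removes the overlaps without
      altering the traces on \<open>X\<close>.\<close>
    let ?B = "disjointed B"
    have B': "?B i \<in> sets borel" for i
      using sets.range_disjointed_sets[of B borel] B(1) by auto
    have SB: "S i = X \<inter> ?B i" for i
    proof -
      have "S i \<inter> S k = {}" if "k < i" for k
        using S(2) that by (auto simp: disjoint_family_on_def)
      then show ?thesis
        unfolding disjointed_def B(2) by fastforce
    qed
    have "(\<Union>i. S i) = X \<inter> (\<Union>i. ?B i)"
      using SB by blast
    then have "\<mu> (\<Union>i. S i) = emeasure lborel ((\<Union>i. ?B i) \<inter> E)"
      using B' by (simp add: \<mu> sets.countable_UN)
    also have "(\<Union>i. ?B i) \<inter> E = (\<Union>i. ?B i \<inter> E)"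
      by blast
    also have "emeasure lborel \<dots> = (\<Sum>i. emeasure lborel (?B i \<inter> E))"
      using B' E(1) disjoint_family_disjointed[of B]
      by (intro suminf_emeasure[symmetric]) (auto simp: disjoint_family_on_def)
    finally show "(\<Sum>i. \<mu> (S i)) = \<mu> (\<Union>i. S i)"
      using B' by (simp add: SB \<mu>)
  qed
  moreover have "positive ?\<S> \<mu>"
    by (simp add: positive_def \<mu>_def)
  moreover have "sigma_algebra X ?\<S>"
    using sets.sigma_algebra_axioms[of "restrict_space borel X"] by (simp add: space_restrict_space)
  ultimately have em: "emeasure \<nu> (X \<inter> B) = emeasure lborel (B \<inter> E)" if "B \<in> sets borel" for B
    using that \<mu> unfolding \<nu>_def
    by (subst emeasure_measure_of_sigma) (auto simp: sets_restrict_space)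
  have emX: "emeasure \<nu> X = emeasure lborel E"
    using em[of UNIV] by simp
  show thesis
  proof
    show fin: "finite_measure \<nu>"
      using Efin by (intro finite_measureI) (simp add: space emX)
    show "sets \<nu> = ?\<S>"
      by (rule sets)
    show "measure \<nu> X > 0"
      using emX E0 Efin by (simp add: measure_def enn2real_positive_iff zero_less_iff_neq_zero)
    fix x assume x: "x \<in> X"
    have "emeasure \<nu> (X \<inter> {x}) = emeasure lborel ({x} \<inter> E)"
      by (rule em) simp
    also have "\<dots> \<le> emeasure lborel {x}"
      by (rule emeasure_mono) simp_all
    also have "\<dots> = 0"
      by simp
    finally have "emeasure \<nu> (X \<inter> {x}) = 0"
      by simp
    moreover have "X \<inter> {x} \<in> sets \<nu>"
      unfolding sets sets_restrict_space by (intro imageI) simp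
    ultimately have "X \<inter> {x} \<in> null_sets \<nu>"
      by (rule null_setsI)
    also have "X \<inter> {x} = {x}"
      using x by blast
    finally show "{x} \<in> null_sets \<nu>" .
  qed
qed

section \<open>The truncated integral as a discontinuous \<open>k_continuous\<close>
  functional\<close>

lemma non_null_Cp_not_kR_space:
  fixes X :: "'a::euclidean_space set"
  assumes "X \<notin> null_sets lebesgue"
  shows "\<not> kR_space (Cp (top_of_set X))"
proof -
  let ?Z = "top_of_set X"
  obtain \<nu> where "finite_measure \<nu>" and sets: "sets \<nu> = sets (restrict_space borel X)"
      and pos: "measure \<nu> X > 0" and null: "\<And>x. x \<in> X \<Longrightarrow> {x} \<in> null_sets \<nu>"
    using non_null_trace_measure[OF assms] by blast
  interpret finite_measure \<nu> by fact
  have space: "space \<nu> = X"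
    using sets_eq_imp_space_eq[OF sets] by (simp add: space_restrict_space)
  have meas: "f \<in> borel_measurable \<nu>" if "f \<in> real_continuous_functions ?Z" for f
    using that borel_measurable_continuous_on_restrict[of X f]
    by (simp add: real_continuous_functions_def measurable_cong_sets[OF sets refl])
  \<comment> \<open>Because of the truncation, the constant 1, integrable for the finite measure
    \<open>\<nu>\<close>, dominates all integrands at once.\<close>
  define \<Phi> where "\<Phi> f = (\<integral>x. min 1 \<bar>f x\<bar> \<partial>\<nu>)" for f :: "'a \<Rightarrow> real"
  have "k_continuous (Cp ?Z) \<Phi>"
    unfolding k_continuous_def
  proof (intro allI impI sequentially_continuous_imp_continuous_map)
    fix K assume K: "compactin (Cp ?Z) K"
    show "metrizable_space (subtopology (Cp ?Z) K)"
      by (intro metrizable_space_compactin_Cp K separable_space_top_of_set)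
    fix \<sigma> f
    assume "range \<sigma> \<subseteq> topspace (subtopology (Cp ?Z) K)"
      and "limitin (subtopology (Cp ?Z) K) \<sigma> f sequentially"
    then have \<sigma>: "\<And>n. \<sigma> n \<in> real_continuous_functions ?Z" and f: "f \<in> real_continuous_functions ?Z"
      and lim: "\<And>x. x \<in> X \<Longrightarrow> (\<lambda>n. \<sigma> n x) \<longlonglongrightarrow> f x"
      by (auto simp: limitin_subtopology limitin_Cp_iff topspace_Cp)
    show "(\<lambda>n. \<Phi> (\<sigma> n)) \<longlonglongrightarrow> \<Phi> f"
      unfolding \<Phi>_def
    proof (rule integral_dominated_convergence[where w = "\<lambda>_. 1"])
      show "(\<lambda>x. min 1 \<bar>\<sigma> n x\<bar>) \<in> borel_measurable \<nu>" for n
        using meas[OF \<sigma>] by measurable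
      show "(\<lambda>x. min 1 \<bar>f x\<bar>) \<in> borel_measurable \<nu>"
        using meas[OF f] by measurable
      show "AE x in \<nu>. (\<lambda>n. min 1 \<bar>\<sigma> n x\<bar>) \<longlonglongrightarrow> min 1 \<bar>f x\<bar>"
        using AE_space by eventually_elim (intro tendsto_intros lim, simp add: space)
    qed auto
  qed
  moreover have "\<not> continuous_map (Cp ?Z) euclideanreal \<Phi>"
  proof
    assume cont: "continuous_map (Cp ?Z) euclideanreal \<Phi>"
    define z where "z = restrict (\<lambda>_. 0 :: real) X"
    define W where "W = {f \<in> topspace (Cp ?Z). \<Phi> f \<in> {..< measure \<nu> X / 2}}"
    have "\<Phi> z = 0"
      unfolding \<Phi>_def by (rule integral_eq_zero_AE) (use AE_space in eventually_elim, simp add: z_def space)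
    moreover have z: "z \<in> real_continuous_functions ?Z"
      by (simp add: z_def real_continuous_functions_def cong: continuous_on_cong)
    ultimately have "z \<in> W"
      using pos by (simp add: W_def topspace_Cp)
    moreover have "openin (Cp ?Z) W"
      unfolding W_def by (intro openin_continuous_map_preimage[OF cont]) auto
    ultimately obtain T where T: "finite T" "T \<subseteq> X"
        "\<And>h. h \<in> real_continuous_functions ?Z \<Longrightarrow> (\<And>x. x \<in> T \<Longrightarrow> h x = z x) \<Longrightarrow> h \<in> W"
      using openin_Cp_finite_dependence by (metis topspace_euclidean_subtopology)
    obtain x0 where x0: "x0 \<in> X"
      using pos by (cases "X = {}") auto
    \<comment> \<open>Adding \<open>x0\<close> keeps the set nonempty: \<open>infdist\<close> to the
      empty set is 0, and then every \<open>h n\<close> would vanish.\<close>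
    let ?T = "insert x0 T"
    \<comment> \<open>Every \<open>h n\<close> vanishes on \<open>T\<close>, as \<open>z\<close>
      does, and so stays in \<open>W\<close>. Off the null set \<open>?T\<close> the values of
      \<open>h n\<close> grow beyond 1, so the integrals tend to \<open>measure \<nu> X\<close>,
      although membership in \<open>W\<close> keeps them below half of it.\<close>
    define h where "h n = restrict (\<lambda>x. real n * infdist x ?T) X" for n
    have hR: "h n \<in> real_continuous_functions ?Z" for n
      by (auto simp: h_def real_continuous_functions_def
          intro!: continuous_intros cong: continuous_on_cong)
    have "h n \<in> W" for n
      using T(2) hR by (intro T(3)) (auto simp: h_def z_def)
    then have lt: "\<Phi> (h n) \<le> measure \<nu> X / 2" for n
      by (auto simp: W_def intro: less_imp_le)
    have "AE x in \<nu>. x \<notin> ?T"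
    proof -
      have "(\<Union>x\<in>?T. {x}) \<in> null_sets \<nu>"
        using T(1,2) x0 null by (intro null_sets_UN') (auto intro: countable_finite)
      then show ?thesis
        using AE_not_in by fastforce
    qed
    have "AE x in \<nu>. (\<lambda>n. min 1 \<bar>h n x\<bar>) \<longlonglongrightarrow> 1"
      using \<open>AE x in \<nu>. x \<notin> ?T\<close> AE_space
    proof eventually_elim
      case (elim x)
      have "infdist x ?T > 0"
        using elim T(1) infdist_pos_not_in_closed[of ?T x] by (simp add: finite_imp_closed)
      then obtain N :: nat where N: "1 < real N * infdist x ?T"
        using reals_Archimedean3 by blast
      have "min 1 \<bar>h n x\<bar> = 1" if "n \<ge> N" for n
      proof -
        have "real N * infdist x ?T \<le> real n * infdist x ?T"
          using that by (intro mult_right_mono) (auto simp: infdist_nonneg)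
        then show ?thesis
          using N elim by (simp add: h_def space)
      qed
      then show ?case
        by (intro tendsto_eventually) (auto simp: eventually_sequentially)
    qed
    then have "(\<lambda>n. \<Phi> (h n)) \<longlonglongrightarrow> (\<integral>x. 1 \<partial>\<nu>)"
      unfolding \<Phi>_def
    proof (intro integral_dominated_convergence[where w = "\<lambda>_. 1"])
      show "(\<lambda>x. min 1 \<bar>h n x\<bar>) \<in> borel_measurable \<nu>" for n
        using meas[OF hR] by measurable
    qed auto
    then have "(\<integral>x. 1 \<partial>\<nu>) \<le> measure \<nu> X / 2"
      using lt by (intro LIMSEQ_le_const2) auto
    then show False
      using pos by (simp add: space)
  qed
  ultimately show ?thesis
    unfolding kR_space_def by blast
qed

text \<open>Otherwise \<open>X \<inter> X = X\<close> would be countable.\<close>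

lemma sierpinski_set_not_null: "sierpinski_set X \<Longrightarrow> X \<notin> null_sets lebesgue"
  unfolding sierpinski_set_def by (metis Int_absorb)

theorem proposition11p19:
  shows "(\<forall>X :: real set. sierpinski_set X \<longrightarrow>
            Ascoli_space (Cp (top_of_set X)) \<and> \<not> sR_space (Cp (top_of_set X))) \<and>
         (continuum_hypothesis \<longrightarrow>
            (\<exists>X :: real topology. separable_space X \<and> metrizable_space X \<and>
               Ascoli_space (Cp X) \<and> \<not> kR_space (Cp X)))"
proof -
  have Ascoli: "Ascoli_space (Cp (top_of_set X))" if "sierpinski_set X" for X
    using that
    by (intro kappa_Frechet_Urysohn_imp_Ascoli_space Tychonoff_space_Cp
        lambda_set_imp_kappa_Frechet_Urysohn_Cp sierpinski_set_imp_lambda_set)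
  have not_kR: "\<not> kR_space (Cp (top_of_set X))" if "sierpinski_set X" for X
    using non_null_Cp_not_kR_space[OF sierpinski_set_not_null[OF that]] .
  have not_sR: "\<not> sR_space (Cp (top_of_set X))" if "sierpinski_set X" for X
    using not_kR[OF that] k_continuous_imp_s_continuous
    unfolding kR_space_def sR_space_def by blast
  have "\<exists>X :: real topology. separable_space X \<and> metrizable_space X \<and>
      Ascoli_space (Cp X) \<and> \<not> kR_space (Cp X)" if CH: continuum_hypothesis
  proof -
    obtain X where "sierpinski_set X"
      using continuum_hypothesis_imp_sierpinski_set[OF CH] by blast
    then show ?thesis
      using Ascoli not_kR
      by (intro exI[of _ "top_of_set X"])
        (simp add: separable_space_top_of_set metrizable_space_subtopology metrizable_space_euclidean)
  qed
  with Ascoli not_sR show ?thesis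
    by blast
qed

end
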